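(* Let $p \in \mathbb{R}$ with $|p| < 1$, let $N \ge 1$ and $k \ge 0$ be integers. Then $$\sum_{n=1}^{N} n^k p^n = \frac{p}{1-p}\left[ (1 - p^N)\, G^{(k)}(0) - p^N \sum_{l=1}^{k} \binom{k}{l} N^l\, G^{(k-l)}(0) \right],$$ where $G^{(j)}(0) = \frac{d^j}{dt^j} G(t)\big|_{t=0}$ is the $j$-th derivative at $0$ of $G(t) = E[e^{tX}]$ for $X \sim \mathrm{Geo}(1-p)$, that is, of $$G(t) = \sum_{n=1}^{\infty} e^{tn} p^{n-1}(1-p)$$ for $t$ in a neighbourhood of $0$.
   Context: $\mathrm{Geo}(1-p)$ denotes the geometric distribution with success probability $1-p$ supported on $\{1, 2, 3, \dots\}$, with mass $p^{n-1}(1-p)$ at $n$. When $p$ is negative, so that this is not a probability distribution, $E[e^{tX}]$ is understood as the displayed convergent series. The convention $0^0 = 1$ is used, and an empty sum is $0$; $G^{(0)}(0) = G(0)$. *)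

theory Defs
  imports "HOL-Probability.Probability"
begin

text \<open>
  The moment generating function of the geometric distribution on \<open>{1, 2, 3, \<dots>}\<close> with
  success probability \<open>1 - p\<close>, given by its series so that it also makes sense for negative \<open>p\<close>.
  The summation index is shifted: the summand at \<open>n\<close> is the contribution of the value \<open>n + 1\<close>.
  The series converges iff \<open>\<bar>p\<bar> * exp t < 1\<close> (when \<open>p \<noteq> 1\<close>); elsewhere the value is irrelevant.
\<close>

definition geo_mgf :: "real \<Rightarrow> real \<Rightarrow> real" where
  "geo_mgf p t = (\<Sum>n. exp (t * real (Suc n)) * p ^ n * (1 - p))"

lemma summable_geo_mgf:
  assumes "\<bar>p\<bar> * exp t < 1"
  shows "summable (\<lambda>n. exp (t * real (Suc n)) * p ^ n * (1 - p))"
proof -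
  have "(\<lambda>n. exp (t * real (Suc n)) * p ^ n * (1 - p)) = (\<lambda>n. exp t * (1 - p) * (p * exp t) ^ n)"
    by (simp add: fun_eq_iff exp_of_nat2_mult power_mult_distrib mult_ac
        del: of_nat_Suc)
  moreover have "summable (\<lambda>n. (p * exp t) ^ n)"
    using assms by (intro summable_geometric) (simp add: abs_mult)
  ultimately show ?thesis
    by (simp add: summable_mult)
qed

lemma eventually_summable_geo_mgf:
  assumes "\<bar>p\<bar> < 1"
  shows "\<forall>\<^sub>F t in nhds 0. summable (\<lambda>n. exp (t * real (Suc n)) * p ^ n * (1 - p))"
proof -
  have "((\<lambda>t. \<bar>p\<bar> * exp t) \<longlongrightarrow> \<bar>p\<bar> * exp 0) (nhds (0::real))"
    by (intro tendsto_intros filterlim_ident)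
  then have "\<forall>\<^sub>F t in nhds (0::real). \<bar>p\<bar> * exp t < 1"
    using assms by (intro order_tendstoD(2)) auto
  then show ?thesis
    by eventually_elim (rule summable_geo_mgf)
qed

text \<open>
  The library's \<^const>\<open>geometric_pmf\<close> is supported on \<open>{0, 1, 2, \<dots>}\<close>, hence the shift by \<^const>\<open>Suc\<close>.
\<close>

lemma geo_mgf_eq_expectation:
  assumes "0 \<le> p" "p < 1" "\<bar>p\<bar> * exp t < 1"
  shows "geo_mgf p t = measure_pmf.expectation (map_pmf Suc (geometric_pmf (1 - p))) (\<lambda>n. exp (t * real n))"
proof -
  let ?f = "\<lambda>n. exp (t * real (Suc n)) * p ^ n * (1 - p)"
  have nonneg: "?f n \<ge> 0" for n
    using assms by simp
  have int: "integrable (count_space UNIV) ?f"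
    unfolding integrable_count_space_nat_iff real_norm_def abs_of_nonneg[OF nonneg]
    by (rule summable_geo_mgf[OF assms(3)])
  have "measure_pmf.expectation (map_pmf Suc (geometric_pmf (1 - p))) (\<lambda>n. exp (t * real n))
      = measure_pmf.expectation (geometric_pmf (1 - p)) (\<lambda>n. exp (t * real (Suc n)))"
    by simp
  also have "\<dots> = (\<integral>n. pmf (geometric_pmf (1 - p)) n * exp (t * real (Suc n)) \<partial>count_space UNIV)"
    by (simp add: measure_pmf_eq_density integral_density del: pmf_geometric)
  also have "(\<lambda>n. pmf (geometric_pmf (1 - p)) n * exp (t * real (Suc n))) = ?f"
    using assms by (simp add: fun_eq_iff)
  also have "(\<integral>n. ?f n \<partial>count_space UNIV) = (\<Sum>n. ?f n)"
    by (rule sums_unique[OF sums_integral_count_space_nat[OF int]])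
  finally show ?thesis
    by (simp add: geo_mgf_def)
qed

end

theory Submission
  imports Defs
begin

text \<open>
  Put \<open>L j = (\<Sum>n\<ge>1. n ^ j * p ^ n)\<close>. The finite sum in question is \<open>L k\<close> minus its tail beyond \<open>N\<close>.
  Shifting the index by \<open>N\<close>, which mirrors the memorylessness of the geometric distribution, the tail
  becomes \<open>p ^ N * (\<Sum>n\<ge>1. (N + n) ^ k * p ^ n)\<close>, and the binomial theorem expands it into
  \<open>p ^ N\<close> times the sum of the \<open>(k choose l) * N ^ l * L (k - l)\<close> over \<open>l \<le> k\<close>
  (\<open>sum_power_times_geometric\<close>). The summand at \<open>l = 0\<close> is \<open>L k\<close> itself and accounts for the factor
  \<open>1 - p ^ N\<close>.

  The series \<open>L j\<close> is \<open>p / (1 - p)\<close> times the \<open>j\<close>-th moment \<open>E[X ^ j]\<close>, hence it remains to see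
  that differentiating the moment generating function \<open>j\<close> times at \<open>0\<close> yields this moment
  (\<open>higher_deriv_geo_mgf\<close>). The generating function is a power series in \<open>exp t\<close>, so it can be
  differentiated termwise; each differentiation multiplies the contribution of the value \<open>n\<close> by \<open>n\<close>.
\<close>

lemma summable_power_times_geometric:
  fixes q :: real
  assumes "\<bar>q\<bar> < 1"
  shows "summable (\<lambda>n. real n ^ j * q ^ n)"
  using assms
proof (induction j arbitrary: q)
  case 0
  then show ?case by (simp add: summable_geometric)
next
  case (Suc j)
  (* The derivative of the series for j is, up to a factor q, the series for j + 1. *)
  have "summable (\<lambda>n. diffs (\<lambda>n. real n ^ j) n * q ^ n)"
    by (rule termdiff_converges[where K = 1]) (use Suc in auto)
  then have "summable (\<lambda>n. q * (diffs (\<lambda>n. real n ^ j) n * q ^ n))"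
    by (rule summable_mult)
  also have "(\<lambda>n. q * (diffs (\<lambda>n. real n ^ j) n * q ^ n)) = (\<lambda>n. real (Suc n) ^ Suc j * q ^ Suc n)"
    by (simp add: diffs_def fun_eq_iff mult_ac del: of_nat_Suc)
  finally show ?case by (subst (asm) summable_Suc_iff)
qed

lemma summable_Suc_power_times_geometric:
  fixes q :: real
  assumes "\<bar>q\<bar> < 1"
  shows "summable (\<lambda>n. real (Suc n) ^ j * q ^ n)"
proof (cases j)
  case 0
  with assms show ?thesis by (simp add: summable_geometric)
next
  case (Suc i)
  have "summable (\<lambda>n. diffs (\<lambda>n. real n ^ i) n * q ^ n)"
    by (rule termdiff_converges[where K = 1]) (use assms summable_power_times_geometric in auto)
  with Suc show ?thesis by (simp add: diffs_def)
qed

text \<open>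
  This is \<open>E[X ^ j * exp (t * X)]\<close> for a geometric \<open>X\<close>, written as a series so that \<open>p\<close> may be negative.
  Keeping \<open>t\<close> as an argument is what allows the induction over derivatives.
\<close>

definition tilted_moment :: "real \<Rightarrow> nat \<Rightarrow> real \<Rightarrow> real" where
  "tilted_moment p j t = (\<Sum>n. real (Suc n) ^ j * (exp (t * real (Suc n)) * p ^ n * (1 - p)))"

text \<open>
  In the variable \<open>x = exp t\<close> the series is the power series with coefficient
  \<open>n ^ j * p ^ (n - 1) * (1 - p)\<close> at \<open>x ^ n\<close> for \<open>n \<ge> 1\<close>, and \<open>d/dt = x * d/dx\<close> multiplies that
  coefficient by \<open>n\<close>.
\<close>

lemma tilted_moment_has_derivative:
  assumes "\<bar>p\<bar> * exp t < 1"
  shows "(tilted_moment p j has_real_derivative tilted_moment p (Suc j) t) (at t)"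
proof -
  (* The coefficient at 0 is set to 0 explicitly: for j = 0 the power 0 ^ j is 1. *)
  define a where "a = (\<lambda>n. if n = 0 then 0 else real n ^ j * p ^ (n - 1) * (1 - p))"
  have diffs_a: "diffs a n = real (Suc n) ^ Suc j * p ^ n * (1 - p)" for n
    by (simp add: a_def diffs_def del: of_nat_Suc)
  have summable_a: "summable (\<lambda>n. a n * x ^ n)" if "\<bar>p * x\<bar> < 1" for x
  proof -
    have "summable (\<lambda>n. (1 - p) * x * (real (Suc n) ^ j * (p * x) ^ n))"
      using that by (intro summable_mult summable_Suc_power_times_geometric)
    also have "(\<lambda>n. (1 - p) * x * (real (Suc n) ^ j * (p * x) ^ n)) = (\<lambda>n. a (Suc n) * x ^ Suc n)"
      by (simp add: a_def fun_eq_iff power_mult_distrib mult_ac del: of_nat_Suc)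
    finally show ?thesis by (subst (asm) summable_Suc_iff)
  qed
  have moment_eq: "tilted_moment p j s = (\<Sum>n. a n * exp s ^ n)" if "\<bar>p * exp s\<bar> < 1" for s
  proof -
    have "(\<Sum>n. a n * exp s ^ n) = (\<Sum>n. a (Suc n) * exp s ^ Suc n)"
      using suminf_split_head[OF summable_a[OF that]] by (simp add: a_def)
    then show ?thesis
      by (simp add: tilted_moment_def a_def exp_of_nat2_mult mult_ac del: of_nat_Suc power_Suc)
  qed
  have "((\<lambda>s. \<bar>p\<bar> * exp s) \<longlongrightarrow> \<bar>p\<bar> * exp t) (nhds t)"
    by (intro tendsto_intros filterlim_ident)
  then have near: "\<forall>\<^sub>F s in nhds t. \<bar>p * exp s\<bar> < 1"
    using assms by (simp add: abs_mult order_tendstoD(2))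
  (* Termwise differentiation needs convergence at some point beyond exp t. *)
  have "\<forall>\<^sub>F s in at_right t. t < s \<and> \<bar>p * exp s\<bar> < 1"
    using near by (intro eventually_conj eventually_at_right_less) (simp add: eventually_at_filter eventually_mono)
  then obtain u where u: "u > t" "\<bar>p * exp u\<bar> < 1"
    using eventually_happens'[OF trivial_limit_at_right_real] by blast
  have "((\<lambda>x. \<Sum>n. a n * x ^ n) has_real_derivative (\<Sum>n. diffs a n * exp t ^ n)) (at (exp t))"
    by (rule termdiffs_strong[where K = "exp u"]) (use u summable_a in auto)
  then have "((\<lambda>s. \<Sum>n. a n * exp s ^ n) has_real_derivative
      (\<Sum>n. diffs a n * exp t ^ n) * exp t) (at t)"
    by (rule DERIV_chain2) (rule DERIV_exp)
  moreover have "(\<Sum>n. diffs a n * exp t ^ n) * exp t = tilted_moment p (Suc j) t"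
  proof -
    have "summable (\<lambda>n. (1 - p) * (real (Suc n) ^ Suc j * (p * exp t) ^ n))"
      using assms by (intro summable_mult summable_Suc_power_times_geometric) (simp add: abs_mult)
    then have "summable (\<lambda>n. diffs a n * exp t ^ n)"
      by (simp add: diffs_a power_mult_distrib mult_ac del: of_nat_Suc power_Suc)
    then have "(\<Sum>n. diffs a n * exp t ^ n) * exp t = (\<Sum>n. diffs a n * exp t ^ n * exp t)"
      by (rule suminf_mult2)
    then show ?thesis
      by (simp add: tilted_moment_def diffs_a exp_of_nat2_mult mult_ac del: of_nat_Suc)
  qed
  moreover have "\<forall>\<^sub>F s in nhds t. tilted_moment p j s = (\<Sum>n. a n * exp s ^ n)"
    using near by eventually_elim (rule moment_eq)
  ultimately show ?thesis
    by (subst DERIV_cong_ev[OF refl _ refl]) simp_all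
qed

lemma higher_deriv_geo_mgf:
  assumes "\<bar>p\<bar> * exp t < 1"
  shows "(deriv ^^ j) (geo_mgf p) t = tilted_moment p j t"
  using assms
proof (induction j arbitrary: t)
  case 0
  then show ?case by (simp add: geo_mgf_def tilted_moment_def)
next
  case (Suc j)
  have "((\<lambda>s. \<bar>p\<bar> * exp s) \<longlongrightarrow> \<bar>p\<bar> * exp t) (nhds t)"
    by (intro tendsto_intros filterlim_ident)
  then have "\<forall>\<^sub>F s in nhds t. \<bar>p\<bar> * exp s < 1"
    using Suc.prems by (rule order_tendstoD(2))
  then have "\<forall>\<^sub>F s in nhds t. (deriv ^^ j) (geo_mgf p) s = tilted_moment p j s"
    by eventually_elim (rule Suc.IH)
  then have "deriv ((deriv ^^ j) (geo_mgf p)) t = deriv (tilted_moment p j) t"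
    by (rule deriv_cong_ev) simp
  also have "\<dots> = tilted_moment p (Suc j) t"
    by (rule DERIV_imp_deriv[OF tilted_moment_has_derivative[OF Suc.prems]])
  finally show ?case by simp
qed

lemma power_times_geometric_sums:
  assumes "\<bar>p\<bar> < 1"
  shows "(\<lambda>n. real (Suc n) ^ j * p ^ Suc n) sums (p / (1 - p) * (deriv ^^ j) (geo_mgf p) 0)"
proof -
  define M where "M = (\<Sum>n. real (Suc n) ^ j * p ^ n)"
  have M: "(\<lambda>n. real (Suc n) ^ j * p ^ n) sums M"
    unfolding M_def using summable_Suc_power_times_geometric[OF assms] by (rule summable_sums)
  have "(deriv ^^ j) (geo_mgf p) 0 = M * (1 - p)"
    using assms sums_mult2[OF M, of "1 - p"]
    by (simp add: higher_deriv_geo_mgf tilted_moment_def sums_iff mult_ac del: of_nat_Suc)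
  then have "p / (1 - p) * (deriv ^^ j) (geo_mgf p) 0 = p * M"
    using assms by auto
  with sums_mult[OF M, of p] show ?thesis
    by (simp add: mult_ac del: of_nat_Suc)
qed

text \<open>
  The tail of the \<open>k\<close>-th series beyond \<open>N\<close>, shifted back to start at \<open>1\<close>, is a binomial combination
  of the series themselves.
\<close>

lemma sum_power_times_geometric:
  fixes p :: real and L :: "nat \<Rightarrow> real"
  assumes L: "\<And>j. (\<lambda>n. real (Suc n) ^ j * p ^ Suc n) sums L j"
  shows "(\<Sum>n = 1..N. real n ^ k * p ^ n) =
    L k - p ^ N * (\<Sum>l\<le>k. real (k choose l) * real N ^ l * L (k - l))"
proof -
  have "(\<lambda>n. p ^ N * (\<Sum>l\<le>k. real (k choose l) * real N ^ l * (real (Suc n) ^ (k - l) * p ^ Suc n)))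
      sums (p ^ N * (\<Sum>l\<le>k. real (k choose l) * real N ^ l * L (k - l)))"
    by (intro sums_mult sums_sum L)
  also have "(\<lambda>n. p ^ N * (\<Sum>l\<le>k. real (k choose l) * real N ^ l * (real (Suc n) ^ (k - l) * p ^ Suc n)))
      = (\<lambda>n. real (Suc (n + N)) ^ k * p ^ Suc (n + N))"
  proof
    fix n
    have "real (Suc (n + N)) ^ k = (\<Sum>l\<le>k. real (k choose l) * real N ^ l * real (Suc n) ^ (k - l))"
      using binomial_ring[of "real N" "real (Suc n)" k] by (simp add: add_ac)
    then show "p ^ N * (\<Sum>l\<le>k. real (k choose l) * real N ^ l * (real (Suc n) ^ (k - l) * p ^ Suc n))
        = real (Suc (n + N)) ^ k * p ^ Suc (n + N)"
      by (simp add: sum_distrib_left sum_distrib_right power_add mult_ac del: of_nat_Suc)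
  qed
  finally have "(\<lambda>n. real (Suc (n + N)) ^ k * p ^ Suc (n + N))
      sums (p ^ N * (\<Sum>l\<le>k. real (k choose l) * real N ^ l * L (k - l)))" .
  moreover have "(\<lambda>n. real (Suc (n + N)) ^ k * p ^ Suc (n + N))
      sums (L k - (\<Sum>n<N. real (Suc n) ^ k * p ^ Suc n))"
    by (rule sums_split_initial_segment[OF L])
  ultimately have "L k - (\<Sum>n<N. real (Suc n) ^ k * p ^ Suc n)
      = p ^ N * (\<Sum>l\<le>k. real (k choose l) * real N ^ l * L (k - l))"
    by (rule sums_unique2[symmetric])
  moreover have "(\<Sum>n<N. real (Suc n) ^ k * p ^ Suc n) = (\<Sum>n = 1..N. real n ^ k * p ^ n)"
    by (simp only: One_nat_def sum.atLeast1_atMost_eq)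
  ultimately show ?thesis by simp
qed

theorem theorem2:
  fixes p :: real and N k :: nat
  assumes "\<bar>p\<bar> < 1" and "N \<ge> 1"
  shows "(\<Sum>n = 1..N. real n ^ k * p ^ n) =
    p / (1 - p) *
      ((1 - p ^ N) * (deriv ^^ k) (geo_mgf p) 0
        - p ^ N * (\<Sum>l = 1..k. real (k choose l) * real N ^ l * (deriv ^^ (k - l)) (geo_mgf p) 0))"
proof -
  define c where "c = p / (1 - p)"
  define g where "g = (\<lambda>j. (deriv ^^ j) (geo_mgf p) 0)"
  define S where "S = (\<Sum>l = 1..k. real (k choose l) * real N ^ l * g (k - l))"
  have "{..k} = insert 0 {1..k}" by auto
  then have "(\<Sum>l\<le>k. real (k choose l) * real N ^ l * g (k - l)) = g k + S"
    by (simp add: S_def)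
  moreover have "(\<Sum>l\<le>k. real (k choose l) * real N ^ l * (c * g (k - l)))
      = c * (\<Sum>l\<le>k. real (k choose l) * real N ^ l * g (k - l))"
    by (simp add: sum_distrib_left mult_ac)
  ultimately have "(\<Sum>n = 1..N. real n ^ k * p ^ n) = c * g k - p ^ N * (c * (g k + S))"
    using sum_power_times_geometric[OF power_times_geometric_sums[OF assms(1)], of k N]
    by (simp add: c_def g_def)
  also have "\<dots> = c * ((1 - p ^ N) * g k - p ^ N * S)"
    by (simp add: algebra_simps)
  finally show ?thesis by (simp add: c_def g_def S_def)
qed

end
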